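(* Let $(\mathfrak g,[\ ,\ ],\mathfrak q)$ be a quadratic Leibniz algebra, $\mathcal R:\mathfrak g\to\mathfrak g$ a linear map, and $N:\mathfrak g\to\mathfrak g$ a Nijenhuis operator on $(\mathfrak g,[\ ,\ ])$. Suppose that $\pi\in\mathfrak g\otimes\mathfrak g$ is symmetric with $\pi^\sharp=\mathcal R\mathfrak q^\sharp$, and that $$\mathfrak q^\sharp N^*=N\mathfrak q^\sharp.$$ Then $(\mathcal R,N)$ is an RBN-structure on $(\mathfrak g,[\ ,\ ])$ if and only if $(\pi,N)$ is a Leibniz $r-n$ structure on $(\mathfrak g,[\ ,\ ])$.
   Context: $k$ is a field of characteristic $0$; all vector spaces are finite dimensional over $k$. A (left) Leibniz algebra $(\mathfrak g,[\ ,\ ])$ is a vector space with a bilinear bracket satisfying $[x,[y,z]]=[[x,y],z]+[y,[x,z]]$. Put $L(x)y=[x,y]=R(y)x$ and $\langle L^*(x)\alpha,y\rangle=-\langle\alpha,L(x)y\rangle$, $\langle R^*(x)\alpha,y\rangle=-\langle\alpha,R(x)y\rangle$ for $\alpha\in\mathfrak g^*$. $N^*$ is the usual transpose of $N$. A quadratic Leibniz algebra is a Leibniz algebra with a nondegenerate skew-symmetric bilinear form $\mathfrak q\in\wedge^2\mathfrak g^*$ satisfying $\mathfrak q(x,[y,z])=\mathfrak q([x,z]+[z,x],y)$ for all $x,y,z$. The isomorphism $\mathfrak q^\sharp:\mathfrak g^*\to\mathfrak g$ is the inverse of $(\mathfrak q^\sharp)^{-1}:\mathfrak g\to\mathfrak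 g^*$, $\langle(\mathfrak q^\sharp)^{-1}(x),y\rangle=\mathfrak q(x,y)$. A Nijenhuis operator on $\mathfrak g$ is a linear endomorphism $N$ with $[N(x),N(y)]=N([N(x),y]+[x,N(y)]-N[x,y])$. A Rota-Baxter operator on $\mathfrak g$ is a linear map $\mathcal R:\mathfrak g\to\mathfrak g$ with $[\mathcal R(x),\mathcal R(y)]=\mathcal R([\mathcal R(x),y]+[x,\mathcal R(y)])$. RBN-structure: a pair $(\mathcal R,N)$ with $\mathcal R$ a Rota-Baxter operator and $N$ a Nijenhuis operator on $\mathfrak g$ such that $N\mathcal R=\mathcal R N$ and, for all $x,y\in\mathfrak g$, $[x,y]^{N\mathcal R}=[x,y]_N^{\mathcal R}$, where $[x,y]^{T}=[T(x),y]+[x,T(y)]$ for a linear $T:\mathfrak g\to\mathfrak g$ and $[x,y]_N^{\mathcal R}=[N(x),y]^{\mathcal R}+[x,N(y)]^{\mathcal R}-N[x,y]^{\mathcal R}$. For $\pi\in\mathfrak g\otimes\mathfrak g$ let $\pi^\sharp:\mathfrak g^*\to\mathfrak g$, $\langle\pi^\sharp(\alpha),\beta\rangle=\pi(\alpha,\beta)$. Classical Leibniz $r$-matrix: on $E=\mathfrak g\oplus\mathfrak g^*$ let $\mu_\ltimes(x+\alpha,y+\beta)=[x,y]+L^*(x)\beta-(L^*+R^* )(y)\alpha$; let $\widehat{\pi^\sharp}(x+\alpha)=\pi^\sharp(\alpha)$; for bilinear $\mu$ and linear $T$ on $E$ put $\{\mu,T\}^B(u,v)=\mu(T(u),v)+\mu(u,T(v))-T(\mu(u,v))$;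 let $\{\{\pi^\sharp,\pi^\sharp\}\}=-\{\{\mu_\ltimes,\widehat{\pi^\sharp}\}^B,\widehat{\pi^\sharp}\}^B$ restricted to $\mathfrak g^*\times\mathfrak g^*$ (it takes values in $\mathfrak g$); and define $[[\pi,\pi]]\in\otimes^3\mathfrak g$ by $\langle[[\pi,\pi]],\xi_1\otimes\xi_2\otimes\xi_3\rangle=\langle\{\{\pi^\sharp,\pi^\sharp\}\}(\xi_1,\xi_2),\xi_3\rangle$. Then $\pi\in\mathrm{Sym}^2(\mathfrak g)$ is a classical Leibniz $r$-matrix if $[[\pi,\pi]]=0$. Leibniz $r-n$ structure: a pair $(\pi,N)$ with $\pi$ a classical Leibniz $r$-matrix and $N$ a Nijenhuis operator on $\mathfrak g$ such that $N\pi^\sharp=\pi^\sharp N^*$ and, for all $\alpha,\beta\in\mathfrak g^*$, $[\alpha,\beta]^{N\pi^\sharp}=[\alpha,\beta]_{N^*}^{\pi^\sharp}$, where $[\alpha,\beta]^{T}=L^*(T(\alpha))\beta-(L^*+R^* )(T(\beta))\alpha$ for linear $T:\mathfrak g^*\to\mathfrak g$, and $[\alpha,\beta]_{N^*}^{\pi^\sharp}=[N^*(\alpha),\beta]^{\pi^\sharp}+[\alpha,N^*(\beta)]^{\pi^\sharp}-N^*[\alpha,\beta]^{\pi^\sharp}$. *)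

theory Defs
  imports Complex_Main "HOL-Library.Function_Algebras" "HOL-Library.Product_Plus"
begin

text \<open>
  The field \<open>k\<close> is a type of class \<open>field_char_0\<close>, and a vector space is a type with a scalar
  multiplication \<open>s\<close>. The dual space is the set of linear functionals inside the function type
  \<open>'a \<Rightarrow> 'k\<close>, with the pointwise operations of \<open>Function_Algebras\<close>; every statement about
  covectors is relativised to this set.
\<close>

definition dual_space :: "('k::field \<Rightarrow> 'a::ab_group_add \<Rightarrow> 'a) \<Rightarrow> ('a \<Rightarrow> 'k) set" where
  "dual_space s = {\<alpha>. Vector_Spaces.linear s (*) \<alpha>}"

definition transpose_map :: "('a \<Rightarrow> 'a) \<Rightarrow> ('a \<Rightarrow> 'k) \<Rightarrow> ('a \<Rightarrow> 'k)" where
  "transpose_map N \<alpha> = (\<lambda>x. \<alpha> (N x))"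


locale leibniz_algebra = finite_dimensional_vector_space s Basis
  for s :: "'k::field_char_0 \<Rightarrow> 'a::ab_group_add \<Rightarrow> 'a" and Basis :: "'a set" +
  fixes br :: "'a \<Rightarrow> 'a \<Rightarrow> 'a"
  assumes br_linear_right: "Vector_Spaces.linear s s (\<lambda>y. br x y)"
    and br_linear_left: "Vector_Spaces.linear s s (\<lambda>x. br x y)"
    and leibniz: "br x (br y z) = br (br x y) z + br y (br x z)"

locale quadratic_leibniz_algebra = leibniz_algebra s Basis br
  for s :: "'k::field_char_0 \<Rightarrow> 'a::ab_group_add \<Rightarrow> 'a" and Basis :: "'a set"
    and br :: "'a \<Rightarrow> 'a \<Rightarrow> 'a" +
  fixes q :: "'a \<Rightarrow> 'a \<Rightarrow> 'k"
  assumes q_linear_right: "Vector_Spaces.linear s (*) (\<lambda>y. q x y)"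
    and q_linear_left: "Vector_Spaces.linear s (*) (\<lambda>x. q x y)"
    and q_skew: "q x y = - q y x"
    and q_nondegenerate: "(\<And>y. q x y = 0) \<Longrightarrow> x = 0"
    and q_invariant: "q x (br y z) = q (br x z + br z x) y"

text \<open>
  As a curried function, \<open>q\<close> is itself the map \<open>x \<mapsto> q(x, \<cdot>)\<close> from \<open>\<gg>\<close> to its dual, so that
  \<open>q\<^sup>\<sharp>\<close> is its inverse; the value is meaningful only on \<open>dual_space\<close>.
\<close>

definition form_sharp :: "('a \<Rightarrow> 'a \<Rightarrow> 'k) \<Rightarrow> ('a \<Rightarrow> 'k) \<Rightarrow> 'a" where
  "form_sharp q \<alpha> = (THE x. q x = \<alpha>)"


definition nijenhuis_operator ::
  "('k::field \<Rightarrow> 'a::ab_group_add \<Rightarrow> 'a) \<Rightarrow> ('a \<Rightarrow> 'a \<Rightarrow> 'a) \<Rightarrow> ('a \<Rightarrow> 'a) \<Rightarrow> bool" where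
  "nijenhuis_operator s br N \<longleftrightarrow> Vector_Spaces.linear s s N \<and>
     (\<forall>x y. br (N x) (N y) = N (br (N x) y + br x (N y) - N (br x y)))"

definition rota_baxter_operator ::
  "('k::field \<Rightarrow> 'a::ab_group_add \<Rightarrow> 'a) \<Rightarrow> ('a \<Rightarrow> 'a \<Rightarrow> 'a) \<Rightarrow> ('a \<Rightarrow> 'a) \<Rightarrow> bool" where
  "rota_baxter_operator s br R \<longleftrightarrow> Vector_Spaces.linear s s R \<and>
     (\<forall>x y. br (R x) (R y) = R (br (R x) y + br x (R y)))"

text \<open>
  This formula serves both for \<open>{\<mu>, T}\<^sup>B\<close> and for deforming a bracket by \<open>N\<close>: the bracket
  \<open>[x, y]\<close> with lower index \<open>N\<close> and upper index \<open>\<R>\<close> is the deformation of \<open>[x, y]\<^sup>\<R>\<close>, and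
  similarly on \<open>\<gg>\<^sup>*\<close> with \<open>N\<^sup>*\<close> and \<open>\<pi>\<^sup>\<sharp>\<close>.
\<close>

definition deformed_bracket ::
  "('v::ab_group_add \<Rightarrow> 'v \<Rightarrow> 'v) \<Rightarrow> ('v \<Rightarrow> 'v) \<Rightarrow> 'v \<Rightarrow> 'v \<Rightarrow> 'v" where
  "deformed_bracket \<mu> T u v = \<mu> (T u) v + \<mu> u (T v) - T (\<mu> u v)"

definition operator_bracket ::
  "('a::ab_group_add \<Rightarrow> 'a \<Rightarrow> 'a) \<Rightarrow> ('a \<Rightarrow> 'a) \<Rightarrow> 'a \<Rightarrow> 'a \<Rightarrow> 'a" where
  "operator_bracket br T x y = br (T x) y + br x (T y)"

definition rbn_structure ::
  "('k::field \<Rightarrow> 'a::ab_group_add \<Rightarrow> 'a) \<Rightarrow> ('a \<Rightarrow> 'a \<Rightarrow> 'a) \<Rightarrow> ('a \<Rightarrow> 'a) \<Rightarrow> ('a \<Rightarrow> 'a) \<Rightarrow> bool" where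
  "rbn_structure s br R N \<longleftrightarrow>
     rota_baxter_operator s br R \<and> nijenhuis_operator s br N \<and>
     N \<circ> R = R \<circ> N \<and>
     (\<forall>x y. operator_bracket br (N \<circ> R) x y = deformed_bracket (operator_bracket br R) N x y)"


definition L_star :: "('a \<Rightarrow> 'a \<Rightarrow> 'a) \<Rightarrow> 'a \<Rightarrow> ('a \<Rightarrow> 'k::field) \<Rightarrow> ('a \<Rightarrow> 'k)" where
  "L_star br x \<alpha> = (\<lambda>y. - \<alpha> (br x y))"

definition R_star :: "('a \<Rightarrow> 'a \<Rightarrow> 'a) \<Rightarrow> 'a \<Rightarrow> ('a \<Rightarrow> 'k::field) \<Rightarrow> ('a \<Rightarrow> 'k)" where
  "R_star br x \<alpha> = (\<lambda>y. - \<alpha> (br y x))"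

text \<open>The bracket on \<open>\<gg> \<oplus> \<gg>\<^sup>*\<close>, whose elements \<open>x + \<alpha>\<close> are the pairs \<open>(x, \<alpha>)\<close>.\<close>

definition semidirect_bracket ::
  "('a \<Rightarrow> 'a \<Rightarrow> 'a) \<Rightarrow> 'a \<times> ('a \<Rightarrow> 'k::field) \<Rightarrow> 'a \<times> ('a \<Rightarrow> 'k) \<Rightarrow> 'a \<times> ('a \<Rightarrow> 'k)" where
  "semidirect_bracket br u v =
     (br (fst u) (fst v),
      L_star br (fst u) (snd v) - (L_star br (fst v) (snd u) + R_star br (fst v) (snd u)))"

text \<open>
  Since \<open>\<gg>\<close> is finite dimensional, \<open>\<gg> \<otimes> \<gg>\<close> is the space of bilinear forms on \<open>\<gg>\<^sup>*\<close>, an element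
  \<open>\<pi>\<close> being the form \<open>(\<alpha>, \<beta>) \<mapsto> \<pi>(\<alpha>, \<beta>)\<close>; likewise for \<open>\<otimes>\<^sup>3\<gg>\<close> and trilinear forms.
\<close>

definition tensor_square ::
  "('k::field \<Rightarrow> 'a::ab_group_add \<Rightarrow> 'a) \<Rightarrow> (('a \<Rightarrow> 'k) \<Rightarrow> ('a \<Rightarrow> 'k) \<Rightarrow> 'k) set" where
  "tensor_square s = {\<pi>. \<forall>\<alpha>\<in>dual_space s. \<forall>\<beta>\<in>dual_space s. \<forall>\<gamma>\<in>dual_space s. \<forall>c.
     \<pi> (\<alpha> + \<beta>) \<gamma> = \<pi> \<alpha> \<gamma> + \<pi> \<beta> \<gamma> \<and> \<pi> (\<lambda>x. c * \<alpha> x) \<gamma> = c * \<pi> \<alpha> \<gamma> \<and>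
     \<pi> \<gamma> (\<alpha> + \<beta>) = \<pi> \<gamma> \<alpha> + \<pi> \<gamma> \<beta> \<and> \<pi> \<gamma> (\<lambda>x. c * \<alpha> x) = c * \<pi> \<gamma> \<alpha>}"

definition sym_square ::
  "('k::field \<Rightarrow> 'a::ab_group_add \<Rightarrow> 'a) \<Rightarrow> (('a \<Rightarrow> 'k) \<Rightarrow> ('a \<Rightarrow> 'k) \<Rightarrow> 'k) set" where
  "sym_square s = {\<pi> \<in> tensor_square s. \<forall>\<alpha>\<in>dual_space s. \<forall>\<beta>\<in>dual_space s. \<pi> \<alpha> \<beta> = \<pi> \<beta> \<alpha>}"

definition tensor_sharp ::
  "('k::field \<Rightarrow> 'a::ab_group_add \<Rightarrow> 'a) \<Rightarrow> (('a \<Rightarrow> 'k) \<Rightarrow> ('a \<Rightarrow> 'k) \<Rightarrow> 'k) \<Rightarrow> ('a \<Rightarrow> 'k) \<Rightarrow> 'a" where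
  "tensor_sharp s \<pi> \<alpha> = (THE x. \<forall>\<beta>\<in>dual_space s. \<beta> x = \<pi> \<alpha> \<beta>)"

definition hat_map :: "(('a \<Rightarrow> 'k) \<Rightarrow> 'a) \<Rightarrow> 'a \<times> ('a \<Rightarrow> 'k::field) \<Rightarrow> 'a \<times> ('a \<Rightarrow> 'k)" where
  "hat_map T u = (T (snd u), 0)"

text \<open>On \<open>\<gg>\<^sup>* \<times> \<gg>\<^sup>*\<close> the iterated bracket takes values in \<open>\<gg>\<close>, hence the first projection.\<close>

definition self_bracket ::
  "('a::ab_group_add \<Rightarrow> 'a \<Rightarrow> 'a) \<Rightarrow> (('a \<Rightarrow> 'k::field) \<Rightarrow> 'a) \<Rightarrow> ('a \<Rightarrow> 'k) \<Rightarrow> ('a \<Rightarrow> 'k) \<Rightarrow> 'a" where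
  "self_bracket br T \<xi> \<eta> =
     fst (- deformed_bracket (deformed_bracket (semidirect_bracket br) (hat_map T)) (hat_map T)
            (0, \<xi>) (0, \<eta>))"

definition tensor_bracket ::
  "('k::field \<Rightarrow> 'a::ab_group_add \<Rightarrow> 'a) \<Rightarrow> ('a \<Rightarrow> 'a \<Rightarrow> 'a) \<Rightarrow> (('a \<Rightarrow> 'k) \<Rightarrow> ('a \<Rightarrow> 'k) \<Rightarrow> 'k) \<Rightarrow>
   ('a \<Rightarrow> 'k) \<Rightarrow> ('a \<Rightarrow> 'k) \<Rightarrow> ('a \<Rightarrow> 'k) \<Rightarrow> 'k" where
  "tensor_bracket s br \<pi> \<xi>1 \<xi>2 \<xi>3 = \<xi>3 (self_bracket br (tensor_sharp s \<pi>) \<xi>1 \<xi>2)"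

definition classical_leibniz_r_matrix ::
  "('k::field \<Rightarrow> 'a::ab_group_add \<Rightarrow> 'a) \<Rightarrow> ('a \<Rightarrow> 'a \<Rightarrow> 'a) \<Rightarrow>
   (('a \<Rightarrow> 'k) \<Rightarrow> ('a \<Rightarrow> 'k) \<Rightarrow> 'k) \<Rightarrow> bool" where
  "classical_leibniz_r_matrix s br \<pi> \<longleftrightarrow> \<pi> \<in> sym_square s \<and>
     (\<forall>\<xi>1\<in>dual_space s. \<forall>\<xi>2\<in>dual_space s. \<forall>\<xi>3\<in>dual_space s.
        tensor_bracket s br \<pi> \<xi>1 \<xi>2 \<xi>3 = 0)"

definition dual_bracket ::
  "('a \<Rightarrow> 'a \<Rightarrow> 'a) \<Rightarrow> (('a \<Rightarrow> 'k::field) \<Rightarrow> 'a) \<Rightarrow> ('a \<Rightarrow> 'k) \<Rightarrow> ('a \<Rightarrow> 'k) \<Rightarrow> ('a \<Rightarrow> 'k)" where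
  "dual_bracket br T \<alpha> \<beta> =
     L_star br (T \<alpha>) \<beta> - (L_star br (T \<beta>) \<alpha> + R_star br (T \<beta>) \<alpha>)"

definition leibniz_rn_structure ::
  "('k::field \<Rightarrow> 'a::ab_group_add \<Rightarrow> 'a) \<Rightarrow> ('a \<Rightarrow> 'a \<Rightarrow> 'a) \<Rightarrow>
   (('a \<Rightarrow> 'k) \<Rightarrow> ('a \<Rightarrow> 'k) \<Rightarrow> 'k) \<Rightarrow> ('a \<Rightarrow> 'a) \<Rightarrow> bool" where
  "leibniz_rn_structure s br \<pi> N \<longleftrightarrow>
     classical_leibniz_r_matrix s br \<pi> \<and> nijenhuis_operator s br N \<and>
     (\<forall>\<alpha>\<in>dual_space s. N (tensor_sharp s \<pi> \<alpha>) = tensor_sharp s \<pi> (transpose_map N \<alpha>)) \<and>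
     (\<forall>\<alpha>\<in>dual_space s. \<forall>\<beta>\<in>dual_space s.
        dual_bracket br (N \<circ> tensor_sharp s \<pi>) \<alpha> \<beta> =
        deformed_bracket (dual_bracket br (tensor_sharp s \<pi>)) (transpose_map N) \<alpha> \<beta>)"

end

theory Submission imports Defs begin

text \<open>
  The form \<open>q\<close> is an isomorphism \<open>x \<mapsto> q(x, \<cdot>)\<close> from \<open>\<gg>\<close> onto its dual, and every piece of structure
  in the definition of a Leibniz \<open>r\<close>-\<open>n\<close> structure is the image under it of the corresponding
  piece in the definition of an RBN-structure.

  The invariance of \<open>q\<close>, whose right-hand side is symmetric in \<open>x\<close> and \<open>z\<close>, forces
  \<open>q(x, [y, z]) = q(z, [y, x])\<close>. It follows that \<open>q\<close> carries left multiplication by \<open>x\<close> to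
  \<open>L\<^sup>*(x)\<close> and right multiplication by \<open>x\<close> to \<open>-(L\<^sup>* + R\<^sup>*)(x)\<close> (\<open>L_star_q\<close>, \<open>L_R_star_q\<close>): the
  representation of \<open>\<gg>\<close> on its dual is the regular one. Under the identification, then, \<open>\<pi>\<^sup>\<sharp>\<close>
  becomes \<open>\<R>\<close>, the bracket \<open>[\<alpha>, \<beta>]\<close> with upper index \<open>\<pi>\<^sup>\<sharp>\<close> becomes \<open>[x, y]\<close> with upper index \<open>\<R>\<close>
  (\<open>dual_bracket_q\<close>), and \<open>N\<^sup>*\<close> becomes \<open>N\<close> because \<open>q\<^sup>\<sharp> N\<^sup>* = N q\<^sup>\<sharp>\<close>. This settles the
  commutation and the compatibility conditions.

  For the remaining condition, expanding the iterated bracket gives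
  \<open>{{T, T}}(\<xi>, \<eta>) = 2 (T[\<xi>, \<eta>]\<^sup>T - [T\<xi>, T\<eta>])\<close> (\<open>self_bracket_eq\<close>). As \<open>2\<close> is invertible and covectors
  separate points, \<open>\<pi>\<close> is a classical Leibniz \<open>r\<close>-matrix exactly when this defect vanishes for
  \<open>T = \<pi>\<^sup>\<sharp>\<close>, and under the identification it is the defect of the Rota-Baxter identity for \<open>\<R>\<close>.
\<close>

section \<open>The self-bracket of an operator on covectors\<close>

context leibniz_algebra
begin

lemma br_add_right: "br x (y + z) = br x y + br x z"
  and br_add_left: "br (x + y) z = br x z + br y z"
  and br_scale_right: "br x (s c y) = s c (br x y)"
  and br_scale_left: "br (s c x) y = s c (br x y)"
  using br_linear_right[of x] br_linear_left[of z] br_linear_left[of y]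
  by (simp_all add: Vector_Spaces.linear_iff)

lemma br_zero_right: "br x 0 = 0" and br_zero_left: "br 0 x = 0"
  using br_add_right[of x 0 0] br_add_left[of 0 0 x] by simp_all

lemma mem_dual_space_iff:
  "\<alpha> \<in> dual_space s \<longleftrightarrow> (\<forall>x y. \<alpha> (x + y) = \<alpha> x + \<alpha> y) \<and> (\<forall>c x. \<alpha> (s c x) = c * \<alpha> x)"
proof -
  have "vector_space ((*) :: 'k \<Rightarrow> 'k \<Rightarrow> 'k)"
    by unfold_locales (simp_all add: algebra_simps)
  then show ?thesis
    by (auto simp: dual_space_def Vector_Spaces.linear_iff vector_space_axioms)
qed

lemma L_star_dual: "\<alpha> \<in> dual_space s \<Longrightarrow> L_star br x \<alpha> \<in> dual_space s"
  by (simp add: mem_dual_space_iff L_star_def br_add_right br_scale_right)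

lemma R_star_dual: "\<alpha> \<in> dual_space s \<Longrightarrow> R_star br x \<alpha> \<in> dual_space s"
  by (simp add: mem_dual_space_iff R_star_def br_add_left br_scale_left)

lemma zero_dual: "0 \<in> dual_space s"
  by (simp add: mem_dual_space_iff)

lemma add_dual: "\<alpha> \<in> dual_space s \<Longrightarrow> \<beta> \<in> dual_space s \<Longrightarrow> \<alpha> + \<beta> \<in> dual_space s"
  by (simp add: mem_dual_space_iff algebra_simps)

lemma uminus_dual: "\<alpha> \<in> dual_space s \<Longrightarrow> - \<alpha> \<in> dual_space s"
  by (simp add: mem_dual_space_iff)

lemma L_star_zero: "\<alpha> \<in> dual_space s \<Longrightarrow> L_star br 0 \<alpha> = 0"
  and R_star_zero: "\<alpha> \<in> dual_space s \<Longrightarrow> R_star br 0 \<alpha> = 0"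
  and L_star_zero_covector: "L_star br x 0 = 0"
  and R_star_zero_covector: "R_star br x 0 = 0"
proof -
  have "\<alpha> 0 = 0" if "\<alpha> \<in> dual_space s" for \<alpha> :: "'a \<Rightarrow> 'k"
  proof -
    have "\<alpha> (0 + 0) = \<alpha> 0 + \<alpha> 0"
      using that unfolding mem_dual_space_iff by blast
    then show ?thesis by simp
  qed
  then show "\<alpha> \<in> dual_space s \<Longrightarrow> L_star br 0 \<alpha> = 0" "\<alpha> \<in> dual_space s \<Longrightarrow> R_star br 0 \<alpha> = 0"
    by (simp_all add: L_star_def R_star_def br_zero_left br_zero_right fun_eq_iff)
qed (simp_all add: L_star_def R_star_def fun_eq_iff)

text \<open>
  Write \<open>[\<xi>, \<eta>]\<^sup>T = \<alpha> + \<beta>\<close> with \<open>\<alpha> = L\<^sup>*(T\<xi>)\<eta>\<close> and \<open>D = {\<mu>\<^sub>\<ltimes>, T}\<^sup>B\<close>. Since \<open>T\<close> squares to zero on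
  \<open>\<gg> \<oplus> \<gg>\<^sup>*\<close>, the terms \<open>D(T\<xi>, \<eta>)\<close> and \<open>D(\<xi>, T\<eta>)\<close> are \<open>[T\<xi>, T\<eta>] - T\<alpha>\<close> and \<open>[T\<xi>, T\<eta>] - T\<beta>\<close>, and
  \<open>-T D(\<xi>, \<eta>)\<close> is \<open>-T(\<alpha> + \<beta>)\<close>; so each of \<open>[T\<xi>, T\<eta>]\<close> and \<open>T[\<xi>, \<eta>]\<^sup>T\<close> is counted twice.
\<close>

lemma self_bracket_eq:
  assumes add: "\<And>\<alpha> \<beta>. \<alpha> \<in> dual_space s \<Longrightarrow> \<beta> \<in> dual_space s \<Longrightarrow> T (\<alpha> + \<beta>) = T \<alpha> + T \<beta>"
    and \<xi>: "\<xi> \<in> dual_space s" and \<eta>: "\<eta> \<in> dual_space s"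
  defines "d \<equiv> T (dual_bracket br T \<xi> \<eta>) - br (T \<xi>) (T \<eta>)"
  shows "self_bracket br T \<xi> \<eta> = d + d"
proof -
  have T0: "T 0 = 0"
    using add[OF zero_dual zero_dual] by simp
  define \<alpha> where "\<alpha> = L_star br (T \<xi>) \<eta>"
  define \<beta> where "\<beta> = - (L_star br (T \<eta>) \<xi> + R_star br (T \<eta>) \<xi>)"
  have dual: "\<alpha> \<in> dual_space s" "\<beta> \<in> dual_space s"
    using \<xi> \<eta> unfolding \<alpha>_def \<beta>_def
    by (simp_all only: L_star_dual R_star_dual add_dual uminus_dual)
  have bracket: "dual_bracket br T \<xi> \<eta> = \<alpha> + \<beta>"
    unfolding dual_bracket_def \<alpha>_def \<beta>_def by simp
  let ?D = "deformed_bracket (semidirect_bracket br) (hat_map T)"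
  have D1: "?D (T \<xi>, 0) (0, \<eta>) = (br (T \<xi>) (T \<eta>) - T \<alpha>, 0)"
    using \<eta> by (simp add: deformed_bracket_def semidirect_bracket_def hat_map_def T0 br_zero_left
        br_zero_right L_star_zero R_star_zero L_star_zero_covector R_star_zero_covector \<alpha>_def
        flip: zero_prod_def)
  have D2: "?D (0, \<xi>) (T \<eta>, 0) = (br (T \<xi>) (T \<eta>) - T \<beta>, 0)"
    using \<xi> by (simp add: deformed_bracket_def semidirect_bracket_def hat_map_def T0 br_zero_left
        br_zero_right L_star_zero R_star_zero L_star_zero_covector R_star_zero_covector \<beta>_def
        flip: zero_prod_def)
  have D3: "?D (0, \<xi>) (0, \<eta>) = (0, \<alpha> + \<beta>)"
    using \<xi> \<eta> by (simp add: deformed_bracket_def semidirect_bracket_def hat_map_def T0 br_zero_left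
        br_zero_right L_star_zero R_star_zero L_star_zero_covector R_star_zero_covector \<alpha>_def \<beta>_def
        flip: zero_prod_def)
  have "self_bracket br T \<xi> \<eta> =
    - (br (T \<xi>) (T \<eta>) - T \<alpha> + (br (T \<xi>) (T \<eta>) - T \<beta>) - T (\<alpha> + \<beta>))"
    unfolding self_bracket_def deformed_bracket_def[of ?D]
    by (simp add: hat_map_def D1 D2 D3)
  then show ?thesis
    unfolding d_def bracket by (simp add: add dual)
qed

end

section \<open>Identifying the algebra with its dual\<close>

context quadratic_leibniz_algebra
begin

lemma q_dual: "q x \<in> dual_space s"
  using q_linear_right[of x] by (simp add: dual_space_def)

lemma q_add_right: "q x (y + z) = q x y + q x z"
  and q_scale_right: "q x (s c y) = c * q x y"
  using q_dual by (simp_all add: mem_dual_space_iff)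

lemma q_add_left: "q (x + y) = q x + q y"
  and q_scale_left: "q (s c x) y = c * q x y"
  using q_linear_left by (simp_all add: Vector_Spaces.linear_iff fun_eq_iff)

lemma q_diff_left: "q (x - y) = q x - q y"
  using q_add_left[of "x - y" y] by simp

lemma q_inject: "q x = q y \<longleftrightarrow> x = y"
proof
  assume "q x = q y"
  then have "q (x - y) z = 0" for z by (simp add: q_diff_left)
  then show "x = y" using q_nondegenerate[of "x - y"] by simp
qed simp

text \<open>
  Surjectivity is a dimension count. To stay inside endomorphisms of \<open>\<gg>\<close>, the covector \<open>\<alpha>\<close> is
  encoded by the vector \<open>\<Sum>b. \<alpha>(b) b\<close>; the encoding of \<open>x \<mapsto> q(x, \<cdot>)\<close> is then an injective
  endomorphism, hence surjective.
\<close>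

lemma q_surj:
  assumes \<alpha>: "\<alpha> \<in> dual_space s"
  obtains x where "\<alpha> = q x"
proof -
  define \<phi> where "\<phi> = (\<lambda>x. \<Sum>b\<in>Basis. s (q x b) b)"
  have lin: "Vector_Spaces.linear s s \<phi>"
    unfolding \<phi>_def Vector_Spaces.linear_iff
    by (simp add: vector_space_axioms q_add_left q_scale_left scale_left_distrib sum.distrib
        scale_sum_right)
  have coeffs: "f = g" if f: "f \<in> dual_space s" and g: "g \<in> dual_space s"
    and eq: "(\<Sum>b\<in>Basis. s (f b) b) = (\<Sum>b\<in>Basis. s (g b) b)" for f g
  proof -
    have "(\<Sum>b\<in>Basis. s (f b - g b) b) = 0"
      using eq by (simp add: scale_left_diff_distrib sum_subtractf)
    then have on_Basis: "f b = g b" if "b \<in> Basis" for b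
      using independentD[OF independent_Basis finite_Basis order_refl _ that, of "\<lambda>b. f b - g b"]
      by simp
    have "Vector_Spaces.linear s (*) f" "Vector_Spaces.linear s (*) g"
      using f g by (simp_all add: dual_space_def)
    then interpret f: Vector_Spaces.linear s "(*)" f + g: Vector_Spaces.linear s "(*)" g .
    have "f x = g x" for x
    proof (rule span_induct[of x Basis "\<lambda>x. f x = g x"])
      show "x \<in> span Basis" by (simp add: span_Basis)
      show "subspace {x. f x = g x}"
        by (auto simp: subspace_def f.add g.add f.scale g.scale f.zero g.zero)
    qed (use on_Basis in auto)
    then show ?thesis by (rule ext)
  qed
  have "inj \<phi>"
    by (rule injI) (use coeffs[OF q_dual q_dual] in \<open>auto simp: \<phi>_def q_inject\<close>)
  then have "surj \<phi>"
    using lin linear_inj_imp_surj by blast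
  then obtain x where "\<phi> x = (\<Sum>b\<in>Basis. s (\<alpha> b) b)"
    by (metis surjD)
  then have "\<alpha> = q x"
    using coeffs[OF \<alpha> q_dual] by (simp add: \<phi>_def)
  then show thesis by (rule that)
qed

lemma form_sharp_q: "form_sharp q (q x) = x"
  unfolding form_sharp_def by (rule the_equality) (simp_all add: q_inject)

lemma ball_dual_space: "(\<forall>\<alpha>\<in>dual_space s. P \<alpha>) \<longleftrightarrow> (\<forall>x. P (q x))"
  using q_surj q_dual by metis

text \<open>The right-hand side of the invariance identity is symmetric in the two outer arguments.\<close>

lemma q_bracket_swap: "q x (br y z) = q z (br y x)"
  using q_invariant[of x y z] q_invariant[of z y x] by (simp add: add.commute)

lemma L_star_q: "L_star br x (q y) = q (br x y)"
proof
  fix z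
  have "L_star br x (q y) z = - q z (br x y)"
    by (simp add: L_star_def q_bracket_swap[of y x z])
  then show "L_star br x (q y) z = q (br x y) z"
    by (simp add: q_skew[of "br x y" z])
qed

lemma L_R_star_q: "L_star br x (q y) + R_star br x (q y) = - q (br y x)"
proof
  fix z
  have "(L_star br x (q y) + R_star br x (q y)) z = - q y (br x z + br z x)"
    by (simp add: L_star_def R_star_def q_add_right)
  also have "\<dots> = q x (br y z)"
    using q_skew[of y "br x z + br z x"] by (simp add: q_invariant)
  also have "\<dots> = (- q (br y x)) z"
    using q_skew[of z "br y x"] by (simp add: q_bracket_swap[of x y z])
  finally show "(L_star br x (q y) + R_star br x (q y)) z = (- q (br y x)) z" .
qed

lemma dual_bracket_q:
  assumes "\<And>x. T (q x) = R x"
  shows "dual_bracket br T (q x) (q y) = q (operator_bracket br R x y)"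
  unfolding dual_bracket_def assms L_R_star_q
  by (simp add: L_star_q operator_bracket_def q_add_left)

lemma transpose_map_q:
  assumes "Vector_Spaces.linear s s N"
    and "\<forall>\<alpha>\<in>dual_space s. form_sharp q (transpose_map N \<alpha>) = N (form_sharp q \<alpha>)"
  shows "transpose_map N (q x) = q (N x)"
proof -
  have "transpose_map N (q x) \<in> dual_space s"
    using assms(1) q_dual[of x]
    by (simp add: mem_dual_space_iff transpose_map_def Vector_Spaces.linear_iff)
  then obtain y where "transpose_map N (q x) = q y" by (rule q_surj)
  then show ?thesis
    using assms(2) q_dual[of x] by (metis form_sharp_q)
qed

section \<open>Transferring the two structures\<close>

lemma q_double_eq_zero_iff: "(\<forall>z. q z (d + d) = 0) \<longleftrightarrow> d = 0"
proof
  assume "\<forall>z. q z (d + d) = 0"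
  then have "q d z = 0" for z
    using q_skew[of d z] by (simp add: q_add_right flip: mult_2)
  then show "d = 0" by (rule q_nondegenerate)
next
  assume "d = 0"
  then show "\<forall>z. q z (d + d) = 0"
    using q_add_right[of _ 0 0] by simp
qed

text \<open>
  Covectors separate points and \<open>2\<close> is invertible, so the vanishing of the tensor
  \<open>[[\<pi>, \<pi>]]\<close> is that of the defect \<open>\<R>[x, y]\<^sup>\<R> - [\<R>x, \<R>y]\<close>.
\<close>

lemma classical_leibniz_r_matrix_iff_rota_baxter:
  assumes R: "Vector_Spaces.linear s s R"
    and \<pi>: "\<pi> \<in> sym_square s"
    and T: "\<And>x. tensor_sharp s \<pi> (q x) = R x"
  shows "classical_leibniz_r_matrix s br \<pi> \<longleftrightarrow> rota_baxter_operator s br R"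
proof -
  have R_add: "R (x + y) = R x + R y" for x y
    using R by (simp add: Vector_Spaces.linear_iff)
  have T_add: "tensor_sharp s \<pi> (\<alpha> + \<beta>) = tensor_sharp s \<pi> \<alpha> + tensor_sharp s \<pi> \<beta>"
    if "\<alpha> \<in> dual_space s" "\<beta> \<in> dual_space s" for \<alpha> \<beta>
    using that by (auto elim!: q_surj simp: T R_add simp flip: q_add_left)
  define defect where "defect x y = R (operator_bracket br R x y) - br (R x) (R y)" for x y
  have self: "self_bracket br (tensor_sharp s \<pi>) (q x) (q y) = defect x y + defect x y" for x y
    using self_bracket_eq[of "tensor_sharp s \<pi>", OF T_add q_dual q_dual, of x y]
    by (simp add: T dual_bracket_q[of "tensor_sharp s \<pi>" R, OF T] defect_def)
  have "classical_leibniz_r_matrix s br \<pi> \<longleftrightarrow> (\<forall>x y. defect x y = 0)"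
    unfolding classical_leibniz_r_matrix_def tensor_bracket_def ball_dual_space self
      q_double_eq_zero_iff using \<pi> by simp
  also have "\<dots> \<longleftrightarrow> rota_baxter_operator s br R"
    using R by (auto simp: rota_baxter_operator_def defect_def operator_bracket_def)
  finally show ?thesis .
qed

end

theorem theorem6p6:
  fixes s :: "'k::field_char_0 \<Rightarrow> 'a::ab_group_add \<Rightarrow> 'a" and Basis :: "'a set"
    and br :: "'a \<Rightarrow> 'a \<Rightarrow> 'a" and q :: "'a \<Rightarrow> 'a \<Rightarrow> 'k"
    and R N :: "'a \<Rightarrow> 'a" and \<pi> :: "('a \<Rightarrow> 'k) \<Rightarrow> ('a \<Rightarrow> 'k) \<Rightarrow> 'k"
  assumes "quadratic_leibniz_algebra s Basis br q"
    and "Vector_Spaces.linear s s R"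
    and "nijenhuis_operator s br N"
    and "\<pi> \<in> sym_square s"
    and "\<forall>\<alpha>\<in>dual_space s. tensor_sharp s \<pi> \<alpha> = R (form_sharp q \<alpha>)"
    and "\<forall>\<alpha>\<in>dual_space s. form_sharp q (transpose_map N \<alpha>) = N (form_sharp q \<alpha>)"
  shows "rbn_structure s br R N \<longleftrightarrow> leibniz_rn_structure s br \<pi> N"
proof -
  interpret quadratic_leibniz_algebra s Basis br q by (fact assms(1))
  have T: "tensor_sharp s \<pi> (q x) = R x" for x
    using assms(5) q_dual by (simp add: form_sharp_q)
  have tr: "transpose_map N (q x) = q (N x)" for x
    using assms(3,6) by (simp add: transpose_map_q nijenhuis_operator_def)
  have NT: "(N \<circ> tensor_sharp s \<pi>) (q x) = (N \<circ> R) x" for x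
    by (simp add: T)
  note bracket_T = dual_bracket_q[of "tensor_sharp s \<pi>" R, OF T]
  have deformed: "deformed_bracket (dual_bracket br (tensor_sharp s \<pi>)) (transpose_map N) (q x) (q y)
      = q (deformed_bracket (operator_bracket br R) N x y)" for x y
    by (simp add: deformed_bracket_def tr bracket_T q_add_left q_diff_left)
  show ?thesis
    unfolding rbn_structure_def leibniz_rn_structure_def ball_dual_space T tr deformed
      dual_bracket_q[of "N \<circ> tensor_sharp s \<pi>" "N \<circ> R", OF NT] q_inject
      classical_leibniz_r_matrix_iff_rota_baxter[of R \<pi>, OF assms(2,4) T]
    by (auto simp: fun_eq_iff)
qed

end
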